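(* Let $(X_t)_{t>0}$ be a square-integrable real-valued stochastic process, and let $\eta,\theta\in\mathbb{R}$ and $\sigma,\tau\in[0,\infty)$ be constants with $\sigma\tau>0$. Suppose that (1) for all $s,t>0$: $\mathbb{E}(X_t)=0$ and $\mathbb{E}(X_tX_s)=\min\{s,t\}$; (2) for all $0<s<t$: $\mathbb{E}(X_t\mid X_s)=X_s$ and $\mathbb{E}(X_s\mid X_t)=\frac{s}{t}X_t$; (3) for all $0<s<t$: $\mathrm{Var}(X_t\mid X_s)\leq \frac{t-s}{1+\sigma s}\left(1+\eta X_s+\sigma X_s^2\right)$; (4) for all $0<s<t$: $\mathrm{Var}(X_s\mid X_t)\leq \frac{s(t-s)}{t+\tau}\left(1+\theta \frac{X_t}{t}+\tau \frac{X_t^2}{t^2}\right)$. Then $\mathbb{E}(|X_t|^p)<\infty$ for all $t>0$ and all real $p$ with $0\leq p\leq \frac{1}{240\sqrt{\sigma\tau}}$.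
   Context: $\mathrm{Var}(X\mid Y)=\mathbb{E}(X^2\mid Y)-(\mathbb{E}(X\mid Y))^2$ denotes the conditional variance of $X$ given the sigma-field generated by $Y$. (In)equalities between conditional expectations hold almost surely. *)

theory Defs
  imports "HOL-Probability.Probability"
begin

text \<open>
  For a random variable \<open>Y\<close> the preimage algebra below is the sigma-field generated by \<open>Y\<close>;
  \<open>real_cond_exp\<close> is the conditional expectation only if \<open>Y\<close> is measurable and
  \<open>X\<close> integrable.
\<close>

definition cond_exp_given :: "'a measure \<Rightarrow> ('a \<Rightarrow> real) \<Rightarrow> ('a \<Rightarrow> real) \<Rightarrow> 'a \<Rightarrow> real"
  where "cond_exp_given M X Y = real_cond_exp M (vimage_algebra (space M) Y borel) X"

definition cond_var_given :: "'a measure \<Rightarrow> ('a \<Rightarrow> real) \<Rightarrow> ('a \<Rightarrow> real) \<Rightarrow> 'a \<Rightarrow> real"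
  where "cond_var_given M X Y =
    (\<lambda>\<omega>. cond_exp_given M (\<lambda>\<omega>'. (X \<omega>')\<^sup>2) Y \<omega> - (cond_exp_given M X Y \<omega>)\<^sup>2)"

text \<open>
  A process is indexed by all reals, but only its values at positive times are constrained.
\<close>

definition square_integrable_process :: "'a measure \<Rightarrow> (real \<Rightarrow> 'a \<Rightarrow> real) \<Rightarrow> bool"
  where "square_integrable_process M X \<longleftrightarrow>
    (\<forall>t>0. X t \<in> borel_measurable M \<and> integrable M (\<lambda>\<omega>. (X t \<omega>)\<^sup>2))"

end

theory Submission
  imports Defs
begin

text \<open>
  Let \<open>\<epsilon> = sqrt (\<sigma> * \<tau>)\<close>. If \<open>\<epsilon> \<ge> 1/480\<close>, only moments of order at most 2 are claimed. Otherwise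
  take \<open>s = sqrt (\<tau> / \<sigma>)\<close>, \<open>\<delta> = 40 * \<epsilon>\<close> and \<open>r = s / (1 - \<delta>)\<close>: for this choice of times both
  conditional variances between \<open>X s\<close> and \<open>X r\<close> are, for large values of the conditioning variable,
  at most about \<open>2 * \<epsilon> * \<delta>\<close> times its square, hence at most \<open>\<delta>\<^sup>2 / 16\<close> times its square. By
  Chebyshev's inequality \<open>X r\<close> is within \<open>\<bar>X s\<bar> * \<delta> / 2\<close> of its conditional mean \<open>X s\<close>, and \<open>X s\<close>
  within \<open>\<bar>X r\<bar> * \<delta> / 2\<close> of its conditional mean \<open>(1 - \<delta>) * X r\<close>, each except with conditional
  probability at most 1/4; but the two approximations contradict each other. So one of the two
  exceptional events occurs, and the tail of \<open>\<bar>X s\<bar>\<close> at \<open>x\<close> is at most a third of the tail of \<open>\<bar>X r\<bar>\<close>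
  at \<open>(1 - 3/2 * \<delta>) * x\<close>, and vice versa. Iterating this gives polynomial tails whose exponent is of
  order \<open>1 / \<epsilon>\<close>, and Jensen's inequality, applied to the martingale \<open>X t\<close> and to the reversed
  martingale \<open>X t / t\<close>, carries the moment bound from \<open>s\<close> to all other times.
\<close>

section \<open>Jensen's inequality for power moments\<close>

text \<open>\<open>powr p\<close> is increasing and convex on positive reals and
  \<open>1 + \<bar>x\<bar>\<close> is convex. The shift by 1 keeps the base at least 1, which makes
  the powers monotone in the exponent as well.\<close>

lemma convex_on_one_plus_abs_powr:
  assumes "p \<ge> 1"
  shows "convex_on UNIV (\<lambda>x::real. (1 + \<bar>x\<bar>) powr p)"
proof (rule convex_onI)
  fix u x y :: real
  assume u: "0 < u" "u < 1"
  have "\<bar>(1 - u) * x + u * y\<bar> \<le> (1 - u) * \<bar>x\<bar> + u * \<bar>y\<bar>"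
    using abs_triangle_ineq[of "(1 - u) * x" "u * y"] u by (simp add: abs_mult)
  then have "1 + \<bar>(1 - u) * x + u * y\<bar> \<le> (1 - u) * (1 + \<bar>x\<bar>) + u * (1 + \<bar>y\<bar>)"
    by (simp add: algebra_simps)
  then have "(1 + \<bar>(1 - u) * x + u * y\<bar>) powr p \<le> ((1 - u) * (1 + \<bar>x\<bar>) + u * (1 + \<bar>y\<bar>)) powr p"
    using assms by (intro powr_mono2) auto
  also have "\<dots> \<le> (1 - u) * (1 + \<bar>x\<bar>) powr p + u * (1 + \<bar>y\<bar>) powr p"
    using convex_onD[OF powr_convex[OF assms], of u "1 + \<bar>x\<bar>" "1 + \<bar>y\<bar>"] u by simp
  finally show "(1 + \<bar>(1 - u) *\<^sub>R x + u *\<^sub>R y\<bar>) powr p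
      \<le> (1 - u) * (1 + \<bar>x\<bar>) powr p + u * (1 + \<bar>y\<bar>) powr p"
    by simp
qed auto

lemma (in prob_space) finite_measure_subalgebra_vimage:
  fixes X :: "'a \<Rightarrow> real"
  assumes [measurable]: "X \<in> borel_measurable M"
  shows "finite_measure_subalgebra M (vimage_algebra (space M) X borel)"
proof
  show "subalgebra M (vimage_algebra (space M) X borel)"
    unfolding subalgebra_def
    by (auto simp: sets_vimage_algebra intro!: sets.sigma_sets_subset)
qed

text \<open>Conditional Jensen moves the moment from \<open>Y\<close> to \<open>a * X\<close>. Since
  \<open>a \<le> 1\<close>, \<open>1 + \<bar>a * x\<bar>\<close> is at least
  \<open>a * (1 + \<bar>x\<bar>)\<close>, so passing from \<open>a * X\<close> to \<open>X\<close>
  costs only the factor \<open>(1 / a) powr p\<close>. The moment of one time thus yields that of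
  another, earlier or later.\<close>

lemma (in prob_space) integrable_powr_cond_exp_given:
  fixes X Y :: "'a \<Rightarrow> real"
  assumes [measurable]: "X \<in> borel_measurable M" "Y \<in> borel_measurable M"
    and Y: "integrable M Y"
    and p: "p \<ge> 1" "integrable M (\<lambda>\<omega>. (1 + \<bar>Y \<omega>\<bar>) powr p)"
    and a: "0 < a" "a \<le> 1" "AE \<omega> in M. cond_exp_given M Y X \<omega> = a * X \<omega>"
  shows "integrable M (\<lambda>\<omega>. (1 + \<bar>X \<omega>\<bar>) powr p)"
proof -
  interpret F: finite_measure_subalgebra M "vimage_algebra (space M) X borel"
    by (rule finite_measure_subalgebra_vimage) fact
  have "integrable M (\<lambda>\<omega>. (1 + \<bar>cond_exp_given M Y X \<omega>\<bar>) powr p)"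
    unfolding cond_exp_given_def
    by (rule F.integrable_convex_cond_exp[where I = UNIV])
      (use Y p convex_on_one_plus_abs_powr in auto)
  then have "integrable M (\<lambda>\<omega>. (1 + \<bar>a * X \<omega>\<bar>) powr p)"
  proof (rule integrable_cong_AE_imp)
    show "AE \<omega> in M. (1 + \<bar>cond_exp_given M Y X \<omega>\<bar>) powr p = (1 + \<bar>a * X \<omega>\<bar>) powr p"
      using a(3) by eventually_elim simp
  qed measurable
  then have "integrable M (\<lambda>\<omega>. (1 / a) powr p * (1 + \<bar>a * X \<omega>\<bar>) powr p)"
    by simp
  then show ?thesis
  proof (rule Bochner_Integration.integrable_bound)
    have "(1 + \<bar>x\<bar>) powr p \<le> (1 / a) powr p * (1 + \<bar>a * x\<bar>) powr p" for x
    proof -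
      have "1 + \<bar>x\<bar> \<le> (1 / a) * (1 + \<bar>a * x\<bar>)"
        using a by (simp add: abs_mult field_simps)
      then have "(1 + \<bar>x\<bar>) powr p \<le> ((1 / a) * (1 + \<bar>a * x\<bar>)) powr p"
        using p by (intro powr_mono2) auto
      then show ?thesis
        using a by (subst (asm) powr_mult) auto
    qed
    then show "AE \<omega> in M. norm ((1 + \<bar>X \<omega>\<bar>) powr p)
        \<le> norm ((1 / a) powr p * (1 + \<bar>a * X \<omega>\<bar>) powr p)"
      by simp
  qed measurable
qed

section \<open>Conditional variance and Chebyshev's inequality\<close>

text \<open>Expand the square: given \<open>X\<close>, the mean of \<open>Y\<close> is
  \<open>a * X\<close>, so the cross term becomes a multiple of the weighted integral of
  \<open>X\<close> squared and the rest is the conditional variance. A bounded weight keeps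
  everything integrable with second moments alone.\<close>

lemma (in prob_space) integral_weighted_cond_var_given:
  fixes X Y :: "'a \<Rightarrow> real"
  assumes [measurable]: "X \<in> borel_measurable M" "Y \<in> borel_measurable M"
    "g \<in> borel_measurable borel"
    and X2: "integrable M (\<lambda>\<omega>. (X \<omega>)\<^sup>2)" and Y2: "integrable M (\<lambda>\<omega>. (Y \<omega>)\<^sup>2)"
    and g: "\<And>x. \<bar>g x\<bar> \<le> B"
    and ce: "AE \<omega> in M. cond_exp_given M Y X \<omega> = a * X \<omega>"
  shows "integrable M (\<lambda>\<omega>. g (X \<omega>) * (Y \<omega> - a * X \<omega>)\<^sup>2)"
    and "integrable M (\<lambda>\<omega>. g (X \<omega>) * cond_var_given M Y X \<omega>)"
    and "(\<integral>\<omega>. g (X \<omega>) * (Y \<omega> - a * X \<omega>)\<^sup>2 \<partial>M) = (\<integral>\<omega>. g (X \<omega>) * cond_var_given M Y X \<omega> \<partial>M)"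
proof -
  let ?F = "vimage_algebra (space M) X borel"
  interpret F: finite_measure_subalgebra M ?F
    by (rule finite_measure_subalgebra_vimage) fact
  have XF [measurable]: "X \<in> borel_measurable ?F"
    by (rule measurable_vimage_algebra1) auto
  have B: "\<bar>g x * z\<bar> \<le> B * \<bar>z\<bar>" for x z
    using g[of x] by (simp add: abs_mult mult_right_mono)
  have g_integrable: "integrable M (\<lambda>\<omega>. g (X \<omega>) * f \<omega>)" if f: "integrable M f" for f
  proof (rule Bochner_Integration.integrable_bound)
    show "integrable M (\<lambda>\<omega>. B * \<bar>f \<omega>\<bar>)" using f by simp
    show "AE \<omega> in M. norm (g (X \<omega>) * f \<omega>) \<le> norm (B * \<bar>f \<omega>\<bar>)"
      unfolding real_norm_def by (intro always_eventually allI order.trans[OF B abs_ge_self])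
  qed (use f in measurable)
  note gY = g_integrable[OF Y2] and gX = g_integrable[OF X2]
  have XY: "integrable M (\<lambda>\<omega>. X \<omega> * Y \<omega>)"
  proof (rule Bochner_Integration.integrable_bound[OF Bochner_Integration.integrable_add[OF X2 Y2]])
    have "\<bar>x * y\<bar> \<le> x\<^sup>2 + y\<^sup>2" for x y :: real
    proof -
      have "2 * \<bar>x * y\<bar> \<le> x\<^sup>2 + y\<^sup>2"
        using sum_squares_bound[of "\<bar>x\<bar>" "\<bar>y\<bar>"] by (simp add: abs_mult)
      then show ?thesis
        using abs_ge_zero[of "x * y"] by linarith
    qed
    then show "AE \<omega> in M. norm (X \<omega> * Y \<omega>) \<le> norm ((X \<omega>)\<^sup>2 + (Y \<omega>)\<^sup>2)"
      by simp
  qed measurable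
  \<comment> \<open>The factor \<open>g (X \<omega>) * X \<omega>\<close> need not be bounded; it
    can be pulled through the conditional expectation because its product with \<open>Y\<close> is
    integrable.\<close>
  have gXY: "integrable M (\<lambda>\<omega>. (g (X \<omega>) * X \<omega>) * Y \<omega>)"
    using g_integrable[OF XY] by (simp add: mult.assoc)
  have gE2: "integrable M (\<lambda>\<omega>. g (X \<omega>) * cond_exp_given M (\<lambda>\<omega>. (Y \<omega>)\<^sup>2) X \<omega>)"
    "(\<integral>\<omega>. g (X \<omega>) * cond_exp_given M (\<lambda>\<omega>. (Y \<omega>)\<^sup>2) X \<omega> \<partial>M) = (\<integral>\<omega>. g (X \<omega>) * (Y \<omega>)\<^sup>2 \<partial>M)"
    unfolding cond_exp_given_def by (rule F.real_cond_exp_intg; use gY in measurable)+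
  have "(\<integral>\<omega>. (g (X \<omega>) * X \<omega>) * Y \<omega> \<partial>M) = (\<integral>\<omega>. (g (X \<omega>) * X \<omega>) * cond_exp_given M Y X \<omega> \<partial>M)"
    unfolding cond_exp_given_def by (rule F.real_cond_exp_intg(2)[symmetric]; use gXY in measurable)
  also have "\<dots> = (\<integral>\<omega>. a * (g (X \<omega>) * (X \<omega>)\<^sup>2) \<partial>M)"
  proof (rule integral_cong_AE)
    show "AE \<omega> in M. g (X \<omega>) * X \<omega> * cond_exp_given M Y X \<omega> = a * (g (X \<omega>) * (X \<omega>)\<^sup>2)"
      using ce by eventually_elim (simp add: power2_eq_square)
  qed (simp_all add: cond_exp_given_def)
  finally have E1: "(\<integral>\<omega>. (g (X \<omega>) * X \<omega>) * Y \<omega> \<partial>M) = a * (\<integral>\<omega>. g (X \<omega>) * (X \<omega>)\<^sup>2 \<partial>M)"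
    by simp
  have expand: "g (X \<omega>) * (Y \<omega> - a * X \<omega>)\<^sup>2
      = g (X \<omega>) * (Y \<omega>)\<^sup>2 - 2 * a * (g (X \<omega>) * X \<omega> * Y \<omega>) + a\<^sup>2 * (g (X \<omega>) * (X \<omega>)\<^sup>2)" for \<omega>
    by (simp add: power2_eq_square algebra_simps)
  show "integrable M (\<lambda>\<omega>. g (X \<omega>) * (Y \<omega> - a * X \<omega>)\<^sup>2)"
    unfolding expand using gX gY gXY by simp
  \<comment> \<open>The weighted conditional variance with the conditional mean replaced by
    \<open>a * X\<close>.\<close>
  let ?r = "\<lambda>\<omega>. g (X \<omega>) * cond_exp_given M (\<lambda>\<omega>. (Y \<omega>)\<^sup>2) X \<omega> - a\<^sup>2 * (g (X \<omega>) * (X \<omega>)\<^sup>2)"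
  have r: "AE \<omega> in M. g (X \<omega>) * cond_var_given M Y X \<omega> = ?r \<omega>"
    using ce by eventually_elim (simp add: cond_var_given_def power_mult_distrib algebra_simps)
  have [measurable]: "(\<lambda>\<omega>. g (X \<omega>) * cond_var_given M Y X \<omega>) \<in> borel_measurable M"
    unfolding cond_var_given_def cond_exp_given_def by measurable
  have [measurable]: "cond_exp_given M (\<lambda>\<omega>. (Y \<omega>)\<^sup>2) X \<in> borel_measurable M"
    unfolding cond_exp_given_def by measurable
  have ir: "integrable M ?r"
    using gE2(1) gX by simp
  show "integrable M (\<lambda>\<omega>. g (X \<omega>) * cond_var_given M Y X \<omega>)"
    by (rule integrable_cong_AE_imp[OF ir]) (use r in \<open>auto simp: eq_commute\<close>)
  have "(\<integral>\<omega>. g (X \<omega>) * cond_var_given M Y X \<omega> \<partial>M) = (\<integral>\<omega>. ?r \<omega> \<partial>M)"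
    by (rule integral_cong_AE) (use r in measurable)
  also have "\<dots> = (\<integral>\<omega>. g (X \<omega>) * (Y \<omega> - a * X \<omega>)\<^sup>2 \<partial>M)"
    unfolding expand using gX gY gXY gE2 E1 by (simp add: power2_eq_square)
  finally show "(\<integral>\<omega>. g (X \<omega>) * (Y \<omega> - a * X \<omega>)\<^sup>2 \<partial>M) = (\<integral>\<omega>. g (X \<omega>) * cond_var_given M Y X \<omega> \<partial>M)"
    by simp
qed

text \<open>This is the conditional Chebyshev inequality with a threshold proportional to
  \<open>\<bar>X\<bar>\<close>, integrated over the tail event of \<open>X\<close>. The function
  \<open>h\<close> is the given bound on the conditional variance; only its size for large arguments
  matters.\<close>

lemma (in prob_space) cond_var_given_Chebyshev:
  fixes X Y :: "'a \<Rightarrow> real"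
  assumes [measurable]: "X \<in> borel_measurable M" "Y \<in> borel_measurable M"
    and X2: "integrable M (\<lambda>\<omega>. (X \<omega>)\<^sup>2)" and Y2: "integrable M (\<lambda>\<omega>. (Y \<omega>)\<^sup>2)"
    and ce: "AE \<omega> in M. cond_exp_given M Y X \<omega> = a * X \<omega>"
    and cv: "AE \<omega> in M. cond_var_given M Y X \<omega> \<le> h (X \<omega>)"
    and h: "\<And>u. \<bar>u\<bar> \<ge> x \<Longrightarrow> h u \<le> v * (c * u)\<^sup>2"
    and "x > 0" "c > 0"
  shows "prob {\<omega> \<in> space M. x \<le> \<bar>X \<omega>\<bar> \<and> c * \<bar>X \<omega>\<bar> \<le> \<bar>Y \<omega> - a * X \<omega>\<bar>}
    \<le> v * prob {\<omega> \<in> space M. x \<le> \<bar>X \<omega>\<bar>}"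
proof -
  \<comment> \<open>Dividing by the squared threshold makes the weighted squared deviation at least
    1 on the exceptional event and the weighted conditional variance at most \<open>v\<close> on the
    tail. The cutoff at \<open>x > 0\<close> makes \<open>g\<close> bounded.\<close>
  define g where "g u = (if x \<le> \<bar>u\<bar> then 1 / (c * u)\<^sup>2 else 0)" for u
  have [measurable]: "g \<in> borel_measurable borel"
    unfolding g_def by measurable
  have g_bound: "\<bar>g u\<bar> \<le> 1 / (c * x)\<^sup>2" for u
  proof (cases "x \<le> \<bar>u\<bar>")
    case True
    then have "(c * x)\<^sup>2 \<le> (c * u)\<^sup>2"
      using \<open>x > 0\<close> \<open>c > 0\<close> by (intro abs_le_square_iff[THEN iffD1]) (auto simp: abs_mult)
    then show ?thesis
      using True \<open>x > 0\<close> \<open>c > 0\<close> by (auto simp: g_def intro!: divide_left_mono)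
  qed (simp add: g_def)
  note dev = integral_weighted_cond_var_given[OF assms(1,2) \<open>g \<in> _\<close> X2 Y2 g_bound ce]
  let ?D = "{\<omega> \<in> space M. x \<le> \<bar>X \<omega>\<bar> \<and> c * \<bar>X \<omega>\<bar> \<le> \<bar>Y \<omega> - a * X \<omega>\<bar>}"
  let ?T = "{\<omega> \<in> space M. x \<le> \<bar>X \<omega>\<bar>}"
  have "prob ?D = (\<integral>\<omega>. indicator ?D \<omega> \<partial>M)"
    by simp
  also have "\<dots> \<le> (\<integral>\<omega>. g (X \<omega>) * (Y \<omega> - a * X \<omega>)\<^sup>2 \<partial>M)"
  proof (rule integral_mono)
    fix \<omega>
    show "indicator ?D \<omega> \<le> g (X \<omega>) * (Y \<omega> - a * X \<omega>)\<^sup>2"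
    proof (cases "\<omega> \<in> ?D")
      case True
      then have "(c * X \<omega>)\<^sup>2 \<le> (Y \<omega> - a * X \<omega>)\<^sup>2"
        using \<open>c > 0\<close> by (intro abs_le_square_iff[THEN iffD1]) (auto simp: abs_mult)
      moreover have "0 < (c * X \<omega>)\<^sup>2"
        using True \<open>x > 0\<close> \<open>c > 0\<close> by auto
      ultimately show ?thesis
        using True by (simp add: g_def)
    qed (simp add: g_def)
  qed (use dev(1) in \<open>auto simp: less_top[symmetric]\<close>)
  also have "\<dots> = (\<integral>\<omega>. g (X \<omega>) * cond_var_given M Y X \<omega> \<partial>M)"
    by (rule dev(3))
  also have "\<dots> \<le> (\<integral>\<omega>. v * indicator ?T \<omega> \<partial>M)"
  proof (rule integral_mono_AE)
    show "AE \<omega> in M. g (X \<omega>) * cond_var_given M Y X \<omega> \<le> v * indicator ?T \<omega>"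
      using cv AE_space
    proof eventually_elim
      case (elim \<omega>)
      show ?case
      proof (cases "x \<le> \<bar>X \<omega>\<bar>")
        case True
        then have "0 < (c * X \<omega>)\<^sup>2"
          using \<open>x > 0\<close> \<open>c > 0\<close> by auto
        moreover have "cond_var_given M Y X \<omega> \<le> v * (c * X \<omega>)\<^sup>2"
          using elim(1) h[OF True] by linarith
        ultimately show ?thesis
          using True elim(2) by (simp add: g_def pos_divide_le_eq del: power_mult_distrib)
      qed (simp add: g_def)
    qed
  qed (use dev(2) in \<open>auto simp: less_top[symmetric]\<close>)
  also have "\<dots> = v * prob ?T"
    by simp
  finally show ?thesis .
qed

section \<open>Tail comparison, and moments from geometric tails\<close>

text \<open>By \<open>dichotomy\<close> the tail event of \<open>X\<close> is covered by the two
  exceptional events. Its probability is therefore at most a quarter of itself plus a quarter of the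
  tail of \<open>Y\<close>; absorbing the first quarter on the left turns 1/4 into 1/3.\<close>

lemma (in prob_space) tail_le_third_tail:
  fixes X Y :: "'a \<Rightarrow> real"
  assumes [measurable]: "X \<in> borel_measurable M" "Y \<in> borel_measurable M"
    and X: "prob {\<omega> \<in> space M. x \<le> \<bar>X \<omega>\<bar> \<and> c * \<bar>X \<omega>\<bar> \<le> \<bar>Y \<omega> - a * X \<omega>\<bar>}
      \<le> 1/4 * prob {\<omega> \<in> space M. x \<le> \<bar>X \<omega>\<bar>}"
    and Y: "prob {\<omega> \<in> space M. y \<le> \<bar>Y \<omega>\<bar> \<and> c * \<bar>Y \<omega>\<bar> \<le> \<bar>X \<omega> - b * Y \<omega>\<bar>}
      \<le> 1/4 * prob {\<omega> \<in> space M. y \<le> \<bar>Y \<omega>\<bar>}"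
    and dichotomy: "\<And>u v. x \<le> \<bar>u\<bar> \<Longrightarrow> \<bar>v - a * u\<bar> < c * \<bar>u\<bar> \<Longrightarrow> y \<le> \<bar>v\<bar> \<and> c * \<bar>v\<bar> \<le> \<bar>u - b * v\<bar>"
  shows "prob {\<omega> \<in> space M. x \<le> \<bar>X \<omega>\<bar>} \<le> 1/3 * prob {\<omega> \<in> space M. y \<le> \<bar>Y \<omega>\<bar>}"
proof -
  let ?D = "{\<omega> \<in> space M. x \<le> \<bar>X \<omega>\<bar> \<and> c * \<bar>X \<omega>\<bar> \<le> \<bar>Y \<omega> - a * X \<omega>\<bar>}"
  let ?E = "{\<omega> \<in> space M. y \<le> \<bar>Y \<omega>\<bar> \<and> c * \<bar>Y \<omega>\<bar> \<le> \<bar>X \<omega> - b * Y \<omega>\<bar>}"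
  have "prob {\<omega> \<in> space M. x \<le> \<bar>X \<omega>\<bar>} \<le> prob (?D \<union> ?E)"
  proof (rule finite_measure_mono)
    show "{\<omega> \<in> space M. x \<le> \<bar>X \<omega>\<bar>} \<subseteq> ?D \<union> ?E"
    proof
      fix \<omega> assume \<omega>: "\<omega> \<in> {\<omega> \<in> space M. x \<le> \<bar>X \<omega>\<bar>}"
      then show "\<omega> \<in> ?D \<union> ?E"
        using dichotomy[of "X \<omega>" "Y \<omega>"] by (cases "c * \<bar>X \<omega>\<bar> \<le> \<bar>Y \<omega> - a * X \<omega>\<bar>") auto
    qed
  qed measurable
  also have "\<dots> \<le> prob ?D + prob ?E"
    by (rule measure_Un_le) measurable
  finally show ?thesis
    using X Y by linarith
qed

text \<open>Cut the range of \<open>\<bar>X\<bar>\<close> at the points \<open>A * K ^ k\<close>.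
  The tail there is at most \<open>q ^ k * N A\<close> while the power grows like
  \<open>(K powr p) ^ k\<close>, so a convergent geometric series dominates the moment. A majorant
  \<open>N\<close> in place of the tail itself admits a contraction that holds only for the sum of
  two tails.\<close>

lemma (in prob_space) integrable_powr_of_geometric_tail:
  fixes X :: "'a \<Rightarrow> real" and N :: "real \<Rightarrow> real"
  assumes [measurable]: "X \<in> borel_measurable M"
    and tail: "\<And>x. A \<le> x \<Longrightarrow> prob {\<omega> \<in> space M. x \<le> \<bar>X \<omega>\<bar>} \<le> N x"
    and N: "\<And>x. A \<le> x \<Longrightarrow> N (K * x) \<le> q * N x"
    and "A > 0" "K > 1" "p \<ge> 0" "q \<ge> 0" "K powr p * q < 1"
  shows "integrable M (\<lambda>\<omega>. (1 + \<bar>X \<omega>\<bar>) powr p)"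
proof -
  have AK: "A \<le> A * K ^ k" for k
    using \<open>A > 0\<close> \<open>K > 1\<close> by simp
  have Nk: "N (A * K ^ k) \<le> q ^ k * N A" for k
  proof (induction k)
    case (Suc k)
    have "N (A * K ^ Suc k) \<le> q * N (A * K ^ k)"
      using N[OF AK[of k]] by (simp add: mult_ac)
    also have "\<dots> \<le> q * (q ^ k * N A)"
      using Suc \<open>q \<ge> 0\<close> by (rule mult_left_mono)
    finally show ?case by (simp add: mult_ac)
  qed simp
  define T where "T k = {\<omega> \<in> space M. A * K ^ k \<le> \<bar>X \<omega>\<bar>}" for k :: nat
  have [measurable]: "T k \<in> sets M" for k
    unfolding T_def by measurable
  \<comment> \<open>On the shell between \<open>A * K ^ k\<close> and \<open>A * K ^ Suc k\<close>,
    \<open>1 + \<bar>X \<omega>\<bar>\<close> is at most \<open>(1 + A) * K ^ Suc k\<close>; the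
    factor \<open>K powr p\<close> in \<open>C\<close> accounts for the outer end of the
    shell.\<close>
  define C where "C = (1 + A) powr p * K powr p"
  let ?w = "\<lambda>k. C * (K powr p) ^ k"
  have C: "C \<ge> 0" by (simp add: C_def)
  have pointwise: "ennreal ((1 + \<bar>X \<omega>\<bar>) powr p)
      \<le> ennreal ((1 + A) powr p) + (\<Sum>k. ennreal (?w k) * indicator (T k) \<omega>)"
    if "\<omega> \<in> space M" for \<omega>
  proof (cases "\<bar>X \<omega>\<bar> < A")
    case True
    then have "ennreal ((1 + \<bar>X \<omega>\<bar>) powr p) \<le> ennreal ((1 + A) powr p)"
      using \<open>p \<ge> 0\<close> by (intro ennreal_leI powr_mono2) auto
    then show ?thesis by (rule add_increasing2[rotated]) simp
  next
    case False
    obtain n where "\<bar>X \<omega>\<bar> / A < K ^ n"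
      using real_arch_pow[OF \<open>K > 1\<close>] by blast
    then have "\<bar>X \<omega>\<bar> < A * K ^ n"
      using \<open>A > 0\<close> by (simp add: field_simps)
    from ex_least_nat_less[of "\<lambda>n. \<bar>X \<omega>\<bar> < A * K ^ n", OF this]
    obtain k where k: "\<bar>X \<omega>\<bar> \<ge> A * K ^ k" "\<bar>X \<omega>\<bar> < A * K ^ Suc k"
      using False by (auto simp: not_less)
    have "1 + \<bar>X \<omega>\<bar> \<le> (1 + A) * K ^ Suc k"
      using k(2) \<open>K > 1\<close> one_le_power[of K "Suc k"] by (auto simp: distrib_right intro!: add_mono)
    then have "(1 + \<bar>X \<omega>\<bar>) powr p \<le> ((1 + A) * K ^ Suc k) powr p"
      using \<open>p \<ge> 0\<close> by (intro powr_mono2) auto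
    also have "\<dots> = ?w k"
    proof -
      have "(K ^ Suc k) powr p = (K powr p) ^ Suc k"
        using \<open>K > 1\<close> powr_realpow[of K "Suc k"] powr_power[of K p "Suc k"]
        by (metis mult.commute not_one_less_zero powr_powr zero_less_one_class.zero_less_one order_less_trans)
      then show ?thesis
        using \<open>A > 0\<close> \<open>K > 1\<close> by (subst powr_mult) (auto simp: C_def)
    qed
    finally have "ennreal ((1 + \<bar>X \<omega>\<bar>) powr p) \<le> ennreal (?w k) * indicator (T k) \<omega>"
      using k(1) that by (simp add: T_def ennreal_leI)
    \<comment> \<open>The sets \<open>T k\<close> are nested, so the sum overcounts; keeping only
      the term of the shell containing \<open>\<bar>X \<omega>\<bar>\<close> is enough for an upper
      bound.\<close>
    also have "\<dots> \<le> (\<Sum>k. ennreal (?w k) * indicator (T k) \<omega>)"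
      using sum_le_suminf[of "\<lambda>k. ennreal (?w k) * indicator (T k) \<omega>" "{k}"]
      by (simp only: summableI finite.intros sum.insert sum.empty empty_iff add_0_right not_False_eq_True zero_le)
    finally show ?thesis
      by (rule add_increasing[rotated]) simp
  qed
  have "(\<integral>\<^sup>+\<omega>. ennreal ((1 + \<bar>X \<omega>\<bar>) powr p) \<partial>M)
      \<le> (\<integral>\<^sup>+\<omega>. ennreal ((1 + A) powr p) + (\<Sum>k. ennreal (?w k) * indicator (T k) \<omega>) \<partial>M)"
    by (rule nn_integral_mono) (rule pointwise)
  also have "\<dots> = ennreal ((1 + A) powr p) + (\<Sum>k. ennreal (?w k) * emeasure M (T k))"
    by (simp add: nn_integral_add nn_integral_suminf nn_integral_cmult emeasure_space_1)
  also have "(\<Sum>k. ennreal (?w k) * emeasure M (T k)) \<le> (\<Sum>k. ennreal (C * N A * (K powr p * q) ^ k))"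
  proof (rule suminf_le)
    fix k
    have "prob (T k) \<le> q ^ k * N A"
      unfolding T_def using tail[OF AK[of k]] Nk[of k] by linarith
    then have "?w k * prob (T k) \<le> ?w k * (q ^ k * N A)"
      using C by (intro mult_left_mono) auto
    also have "\<dots> = C * N A * (K powr p * q) ^ k"
      by (simp add: power_mult_distrib)
    finally show "ennreal (?w k) * emeasure M (T k) \<le> ennreal (C * N A * (K powr p * q) ^ k)"
      using C by (simp add: emeasure_eq_measure ennreal_mult[symmetric] ennreal_leI)
  qed auto
  also have "(\<Sum>k. ennreal (C * N A * (K powr p * q) ^ k)) < \<infinity>"
  proof -
    have "0 \<le> N A"
      using tail[of A] measure_nonneg[of M "{\<omega> \<in> space M. A \<le> \<bar>X \<omega>\<bar>}"] by linarith
    moreover have "summable (\<lambda>k. C * N A * (K powr p * q) ^ k)"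
      using \<open>K powr p * q < 1\<close> \<open>q \<ge> 0\<close> by (intro summable_mult summable_geometric) simp
    ultimately show ?thesis
      using C \<open>q \<ge> 0\<close> by (subst suminf_ennreal2) auto
  qed
  finally have "(\<integral>\<^sup>+\<omega>. ennreal ((1 + \<bar>X \<omega>\<bar>) powr p) \<partial>M) < \<infinity>"
    by (simp add: add_left_mono ennreal_add_less_top)
  then show ?thesis
    by (intro integrableI_nonneg) auto
qed

section \<open>The moment bound for the process\<close>

text \<open>Far from 0 the quadratic term absorbs the constant and the linear term, at the cost of a
  factor 2. This reduces both variance hypotheses to multiples of the squared conditioning
  variable.\<close>

lemma dominated_by_quadratic:
  fixes \<alpha> \<beta> :: real
  assumes "\<beta> > 0"
  shows "\<exists>A>0. \<forall>u. A \<le> \<bar>u\<bar> \<longrightarrow> 1 + \<alpha> * u + \<beta> * u\<^sup>2 \<le> 2 * \<beta> * u\<^sup>2"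
proof (intro exI conjI allI impI)
  let ?A = "1 + (1 + \<bar>\<alpha>\<bar>) / \<beta>"
  show "?A > 0" using assms by (simp add: add_pos_nonneg)
  fix u :: real assume u: "?A \<le> \<bar>u\<bar>"
  have "1 \<le> \<bar>u\<bar>"
    using u assms by (smt (verit) divide_nonneg_pos)
  have "1 + \<bar>\<alpha>\<bar> \<le> \<beta> * \<bar>u\<bar>"
  proof -
    have "(1 + \<bar>\<alpha>\<bar>) / \<beta> \<le> \<bar>u\<bar>" using u by linarith
    then show ?thesis using assms by (simp add: pos_divide_le_eq mult.commute)
  qed
  then have "(1 + \<bar>\<alpha>\<bar>) * \<bar>u\<bar> \<le> \<beta> * \<bar>u\<bar> * \<bar>u\<bar>"
    by (rule mult_right_mono) simp
  moreover have "\<alpha> * u \<le> \<bar>\<alpha>\<bar> * \<bar>u\<bar>"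
    by (metis abs_ge_self abs_mult)
  ultimately have "1 + \<alpha> * u \<le> \<beta> * u\<^sup>2"
    using \<open>1 \<le> \<bar>u\<bar>\<close> by (simp add: power2_eq_square algebra_simps)
  then show "1 + \<alpha> * u + \<beta> * u\<^sup>2 \<le> 2 * \<beta> * u\<^sup>2" by simp
qed

theorem theorem1p1:
  fixes M :: "'a measure" and X :: "real \<Rightarrow> 'a \<Rightarrow> real"
    and \<eta> \<theta> \<sigma> \<tau> :: real
  assumes "prob_space M"
    and "square_integrable_process M X"
    and "\<sigma> \<ge> 0" and "\<tau> \<ge> 0" and "\<sigma> * \<tau> > 0"
    and mean: "\<And>t. t > 0 \<Longrightarrow> (\<integral>\<omega>. X t \<omega> \<partial>M) = 0"
    and covariance: "\<And>s t. s > 0 \<Longrightarrow> t > 0 \<Longrightarrow> (\<integral>\<omega>. X t \<omega> * X s \<omega> \<partial>M) = min s t"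
    and exp_forward: "\<And>s t. 0 < s \<Longrightarrow> s < t \<Longrightarrow>
      AE \<omega> in M. cond_exp_given M (X t) (X s) \<omega> = X s \<omega>"
    and exp_backward: "\<And>s t. 0 < s \<Longrightarrow> s < t \<Longrightarrow>
      AE \<omega> in M. cond_exp_given M (X s) (X t) \<omega> = s / t * X t \<omega>"
    and var_forward: "\<And>s t. 0 < s \<Longrightarrow> s < t \<Longrightarrow>
      AE \<omega> in M. cond_var_given M (X t) (X s) \<omega>
        \<le> (t - s) / (1 + \<sigma> * s) * (1 + \<eta> * X s \<omega> + \<sigma> * (X s \<omega>)\<^sup>2)"
    and var_backward: "\<And>s t. 0 < s \<Longrightarrow> s < t \<Longrightarrow>
      AE \<omega> in M. cond_var_given M (X s) (X t) \<omega>
        \<le> s * (t - s) / (t + \<tau>) * (1 + \<theta> * (X t \<omega> / t) + \<tau> * ((X t \<omega>)\<^sup>2 / t\<^sup>2))"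
  shows "\<forall>t>0. \<forall>p. 0 \<le> p \<and> p \<le> 1 / (240 * sqrt (\<sigma> * \<tau>)) \<longrightarrow>
    (\<integral>\<^sup>+\<omega>. ennreal (\<bar>X t \<omega>\<bar> powr p) \<partial>M) < \<infinity>"
proof -
  interpret prob_space M by fact
  have Xm [measurable]: "X t \<in> borel_measurable M"
    and X2: "integrable M (\<lambda>\<omega>. (X t \<omega>)\<^sup>2)" if "t > 0" for t
    using assms(2) that by (auto simp: square_integrable_process_def)
  have X1: "integrable M (X t)" if "t > 0" for t
    by (rule square_integrable_imp_integrable[OF Xm X2]) (use that in auto)
  define \<epsilon> where "\<epsilon> = sqrt (\<sigma> * \<tau>)"
  have pos: "\<sigma> > 0" "\<tau> > 0" "\<epsilon> > 0"
    using assms(3-5) by (auto simp: \<epsilon>_def zero_less_mult_iff)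
  \<comment> \<open>One exponent that covers every claimed \<open>p\<close>; the lower bound 2 also
    secures \<open>P \<ge> 1\<close>, as Jensen's inequality requires.\<close>
  define P where "P = max 2 (1 / (240 * \<epsilon>))"
  have "P \<ge> 1" by (simp add: P_def)
  have moment: "integrable M (\<lambda>\<omega>. (1 + \<bar>X t \<omega>\<bar>) powr P)" if "t > 0" for t
  proof (cases "\<epsilon> \<ge> 1 / 480")
    case True
    then have P: "P = 2"
      using pos by (simp add: P_def max_def field_simps)
    have "(1 + \<bar>x\<bar>) powr 2 = 1 + 2 * \<bar>x\<bar> + x\<^sup>2" for x :: real
      by (simp add: powr_numeral power2_eq_square algebra_simps)
    then show ?thesis
      unfolding P using X1[OF that] X2[OF that] by simp
  next
    case False
    define s where "s = sqrt (\<tau> / \<sigma>)"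
    define \<delta> where "\<delta> = 40 * \<epsilon>"
    define r where "r = s / (1 - \<delta>)"
    have \<delta>: "0 < \<delta>" "\<delta> \<le> 1 / 12"
      using False pos by (auto simp: \<delta>_def)
    have "s > 0" using pos by (simp add: s_def)
    have "s < r" using \<open>s > 0\<close> \<delta> by (simp add: r_def field_simps)
    have sr: "s / r = 1 - \<delta>" "s = (1 - \<delta>) * r"
      using \<open>s > 0\<close> \<delta> by (auto simp: r_def)
    have "r > 0" using \<open>s > 0\<close> \<open>s < r\<close> by simp
    \<comment> \<open>The time \<open>s\<close> balances the two hypotheses:
      \<open>\<sigma> * s\<close> and \<open>\<tau> / s\<close> both equal
      \<open>\<epsilon>\<close>.\<close>
    have \<sigma>s: "\<sigma> * s = \<epsilon>"
    proof -
      have "\<epsilon>\<^sup>2 = (\<sigma> * s)\<^sup>2"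
        using pos by (simp add: \<epsilon>_def s_def power_mult_distrib power2_eq_square[of \<sigma>])
      then show ?thesis
        using pos \<open>s > 0\<close> by (simp add: power2_eq_iff_nonneg)
    qed
    have \<tau>s: "\<tau> = \<epsilon> * s"
    proof -
      have "s\<^sup>2 = \<tau> / \<sigma>" using pos by (simp add: s_def)
      then have "\<tau> = \<sigma> * s * s" using pos by (simp add: power2_eq_square field_simps)
      then show ?thesis using \<sigma>s by simp
    qed
    define v where "v = 2 * \<epsilon> * \<delta> / (1 - \<delta>)"
    \<comment> \<open>The factor 40 in \<open>\<delta>\<close> is fixed here:
      \<open>5 / 2 * (\<epsilon> * \<delta>)\<close> is exactly
      \<open>\<delta>\<^sup>2 / 16\<close>, which is the conditional probability 1/4 times the
      squared threshold \<open>(\<delta> / 2)\<^sup>2\<close>.\<close>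
    have v: "v \<le> 1/4 * (\<delta> / 2)\<^sup>2"
    proof -
      have "2 / (1 - \<delta>) \<le> 5 / 2"
        using \<delta> by (simp add: field_simps)
      then have "2 / (1 - \<delta>) * (\<epsilon> * \<delta>) \<le> 5 / 2 * (\<epsilon> * \<delta>)"
        using pos \<delta> by (intro mult_right_mono) auto
      then show ?thesis
        by (simp add: v_def \<delta>_def power2_eq_square)
    qed
    obtain A1 where A1: "A1 > 0" "\<And>u. A1 \<le> \<bar>u\<bar> \<Longrightarrow> 1 + \<eta> * u + \<sigma> * u\<^sup>2 \<le> 2 * \<sigma> * u\<^sup>2"
      using dominated_by_quadratic[OF \<open>\<sigma> > 0\<close>, of \<eta>] by blast
    obtain A2 where A2: "A2 > 0"
      "\<And>u. A2 \<le> \<bar>u\<bar> \<Longrightarrow> 1 + \<theta> / r * u + \<tau> / r\<^sup>2 * u\<^sup>2 \<le> 2 * (\<tau> / r\<^sup>2) * u\<^sup>2"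
      using dominated_by_quadratic[of "\<tau> / r\<^sup>2" "\<theta> / r"] pos \<open>r > 0\<close> by auto
    define A where "A = max A1 A2"
    have "A > 0" using A1 by (simp add: A_def)
    have forward: "(r - s) / (1 + \<sigma> * s) * (1 + \<eta> * u + \<sigma> * u\<^sup>2) \<le> 1/4 * (\<delta> / 2 * u)\<^sup>2"
      if "A \<le> \<bar>u\<bar>" for u
    proof -
      have "(r - s) / (1 + \<sigma> * s) * (1 + \<eta> * u + \<sigma> * u\<^sup>2) \<le> (r - s) / (1 + \<sigma> * s) * (2 * \<sigma> * u\<^sup>2)"
        using A1(2)[of u] that \<open>s < r\<close> \<open>s > 0\<close> pos by (intro mult_left_mono) (auto simp: A_def)
      also have "\<dots> \<le> (r - s) / 1 * (2 * \<sigma> * u\<^sup>2)"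
        using \<open>s < r\<close> \<open>s > 0\<close> pos by (intro mult_right_mono divide_left_mono) (auto simp: add_pos_pos)
      also have "(r - s) / 1 * (2 * \<sigma> * u\<^sup>2) = v * u\<^sup>2"
      proof -
        have "(r - s) * \<sigma> = \<epsilon> * \<delta> / (1 - \<delta>)"
          using \<delta> by (simp add: r_def \<sigma>s[symmetric] field_simps)
        then have "(r - s) / 1 * (2 * \<sigma> * u\<^sup>2) = 2 * (\<epsilon> * \<delta> / (1 - \<delta>)) * u\<^sup>2"
          by (metis div_by_1 mult.assoc mult.left_commute)
        then show ?thesis by (simp add: v_def)
      qed
      also have "\<dots> \<le> 1/4 * (\<delta> / 2)\<^sup>2 * u\<^sup>2"
        using v by (rule mult_right_mono) simp
      finally show ?thesis by (simp only: power_mult_distrib mult.assoc)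
    qed
    have backward: "s * (r - s) / (r + \<tau>) * (1 + \<theta> * (u / r) + \<tau> * (u\<^sup>2 / r\<^sup>2)) \<le> 1/4 * (\<delta> / 2 * u)\<^sup>2"
      if "A \<le> \<bar>u\<bar>" for u
    proof -
      have "s * (r - s) / (r + \<tau>) * (1 + \<theta> * (u / r) + \<tau> * (u\<^sup>2 / r\<^sup>2))
          \<le> s * (r - s) / (r + \<tau>) * (2 * (\<tau> / r\<^sup>2) * u\<^sup>2)"
        using A2(2)[of u] that \<open>s < r\<close> \<open>s > 0\<close> pos by (intro mult_left_mono) (auto simp: A_def)
      also have "\<dots> \<le> s * (r - s) / r * (2 * (\<tau> / r\<^sup>2) * u\<^sup>2)"
        using \<open>s < r\<close> \<open>s > 0\<close> pos by (intro mult_right_mono divide_left_mono) (auto simp: add_pos_pos)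
      \<comment> \<open>Substituting \<open>\<tau> = \<epsilon> * s\<close> and
        \<open>s = (1 - \<delta>) * r\<close> cancels every power of \<open>r\<close>. The result
        differs from the forward coefficient \<open>v\<close> by the factor
        \<open>(1 - \<delta>) ^ 3\<close>, which is at most 1.\<close>
      also have "\<dots> = 2 * \<epsilon> * \<delta> * (1 - \<delta>)\<^sup>2 * u\<^sup>2"
        using \<open>r > 0\<close> unfolding \<tau>s sr(2) by (simp add: field_simps power2_eq_square)
      also have "\<dots> \<le> v * u\<^sup>2"
      proof (rule mult_right_mono)
        have "(1 - \<delta>)\<^sup>2 * (1 - \<delta>) \<le> 1"
          using \<delta> by (intro mult_le_one power_le_one) auto
        then have "2 * \<epsilon> * \<delta> * ((1 - \<delta>)\<^sup>2 * (1 - \<delta>)) \<le> 2 * \<epsilon> * \<delta> * 1"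
          using pos \<delta> by (intro mult_left_mono) auto
        then show "2 * \<epsilon> * \<delta> * (1 - \<delta>)\<^sup>2 \<le> v"
          using \<delta> by (simp add: v_def pos_le_divide_eq mult.assoc)
      qed simp
      also have "\<dots> \<le> 1/4 * (\<delta> / 2)\<^sup>2 * u\<^sup>2"
        using v by (rule mult_right_mono) simp
      finally show ?thesis by (simp only: power_mult_distrib mult.assoc)
    qed

    \<comment> \<open>Mutual comparison of the tails at the two times\<close>
    let ?Ps = "\<lambda>x. prob {\<omega> \<in> space M. x \<le> \<bar>X s \<omega>\<bar>}"
    let ?Pr = "\<lambda>x. prob {\<omega> \<in> space M. x \<le> \<bar>X r \<omega>\<bar>}"
    have [measurable]: "X s \<in> borel_measurable M" "X r \<in> borel_measurable M"
      using Xm \<open>s > 0\<close> \<open>r > 0\<close> by auto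
    have cheb_s: "prob {\<omega> \<in> space M. x \<le> \<bar>X s \<omega>\<bar> \<and> \<delta> / 2 * \<bar>X s \<omega>\<bar> \<le> \<bar>X r \<omega> - 1 * X s \<omega>\<bar>} \<le> 1/4 * ?Ps x"
      if "A \<le> x" for x
    proof (rule cond_var_given_Chebyshev[OF _ _ X2 X2])
      show "AE \<omega> in M. cond_exp_given M (X r) (X s) \<omega> = 1 * X s \<omega>"
        using exp_forward[OF \<open>s > 0\<close> \<open>s < r\<close>] by simp
      show "AE \<omega> in M. cond_var_given M (X r) (X s) \<omega>
          \<le> (\<lambda>u. (r - s) / (1 + \<sigma> * s) * (1 + \<eta> * u + \<sigma> * u\<^sup>2)) (X s \<omega>)"
        using var_forward[OF \<open>s > 0\<close> \<open>s < r\<close>] by simp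
    qed (use that forward \<open>s > 0\<close> \<open>r > 0\<close> \<open>A > 0\<close> \<delta> in auto)
    have cheb_r: "prob {\<omega> \<in> space M. x \<le> \<bar>X r \<omega>\<bar> \<and> \<delta> / 2 * \<bar>X r \<omega>\<bar> \<le> \<bar>X s \<omega> - (1 - \<delta>) * X r \<omega>\<bar>} \<le> 1/4 * ?Pr x"
      if "A \<le> x" for x
    proof (rule cond_var_given_Chebyshev[OF _ _ X2 X2])
      show "AE \<omega> in M. cond_exp_given M (X s) (X r) \<omega> = (1 - \<delta>) * X r \<omega>"
        using exp_backward[OF \<open>s > 0\<close> \<open>s < r\<close>] by (simp only: sr(1))
      show "AE \<omega> in M. cond_var_given M (X s) (X r) \<omega>
          \<le> (\<lambda>u. s * (r - s) / (r + \<tau>) * (1 + \<theta> * (u / r) + \<tau> * (u\<^sup>2 / r\<^sup>2))) (X r \<omega>)"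
        using var_backward[OF \<open>s > 0\<close> \<open>s < r\<close>] by simp
    qed (use that backward \<open>s > 0\<close> \<open>r > 0\<close> \<open>A > 0\<close> \<delta> in auto)
    \<comment> \<open>The larger of the two losses sets the scale: \<open>X s\<close> near
      \<open>(1 - \<delta>) * X r\<close> up to \<open>\<delta> / 2\<close> leaves the factor
      \<open>1 - 3 / 2 * \<delta>\<close>, whereas the forward approximation leaves
      \<open>1 - \<delta> / 2\<close>. One \<open>K\<close> serves both directions.\<close>
    define K where "K = 1 / (1 - 3 / 2 * \<delta>)"
    have K: "K > 1" "K * (1 - 3 / 2 * \<delta>) = 1"
      using \<delta> by (auto simp: K_def field_simps)
    have dich_s: "y \<le> \<bar>w\<bar> \<and> \<delta> / 2 * \<bar>w\<bar> \<le> \<bar>u - (1 - \<delta>) * w\<bar>"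
      if "0 < y" "K * y \<le> \<bar>u\<bar>" "\<bar>w - 1 * u\<bar> < \<delta> / 2 * \<bar>u\<bar>" for u w y
    proof -
      have w: "(1 - \<delta> / 2) * \<bar>u\<bar> \<le> \<bar>w\<bar>" "\<bar>w\<bar> \<le> (1 + \<delta> / 2) * \<bar>u\<bar>"
        using that(3) abs_triangle_ineq2[of u w] abs_triangle_ineq2[of w u]
        by (auto simp: algebra_simps abs_minus_commute)
      have "y = (1 - 3 / 2 * \<delta>) * (K * y)"
        using K(2) by (metis mult.assoc mult.commute mult_1)
      also have "\<dots> \<le> (1 - \<delta> / 2) * \<bar>u\<bar>"
        using that \<delta> K(1) by (intro mult_mono) auto
      finally have "y \<le> \<bar>w\<bar>"
        using w(1) by linarith
      \<comment> \<open>The incompatibility of the two approximations comes from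
        \<open>(1 - \<delta> / 2) * (1 + \<delta> / 2) \<le> 1\<close>: the gap
        \<open>\<delta>\<close> between the two slopes is shared equally by the two errors.\<close>
      have "(1 - \<delta> / 2) * \<bar>w\<bar> \<le> (1 - \<delta> / 2) * ((1 + \<delta> / 2) * \<bar>u\<bar>)"
        using w(2) \<delta> by (intro mult_left_mono) auto
      also have "\<dots> = \<bar>u\<bar> - \<delta>\<^sup>2 / 4 * \<bar>u\<bar>"
        by (simp add: power2_eq_square field_simps)
      also have "\<dots> \<le> \<bar>u\<bar>"
        by simp
      finally have "\<delta> / 2 * \<bar>w\<bar> \<le> \<bar>u\<bar> - (1 - \<delta>) * \<bar>w\<bar>"
        by (simp add: algebra_simps)
      also have "(1 - \<delta>) * \<bar>w\<bar> = \<bar>(1 - \<delta>) * w\<bar>"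
        using \<delta> by (simp add: abs_mult)
      also have "\<bar>u\<bar> - \<dots> \<le> \<bar>u - (1 - \<delta>) * w\<bar>"
        by (rule abs_triangle_ineq2)
      finally show ?thesis
        using \<open>y \<le> \<bar>w\<bar>\<close> by simp
    qed
    have dich_r: "y \<le> \<bar>u\<bar> \<and> \<delta> / 2 * \<bar>u\<bar> \<le> \<bar>w - 1 * u\<bar>"
      if "0 < y" "K * y \<le> \<bar>w\<bar>" "\<bar>u - (1 - \<delta>) * w\<bar> < \<delta> / 2 * \<bar>w\<bar>" for u w y
    proof -
      have "\<bar>(1 - \<delta>) * w\<bar> = (1 - \<delta>) * \<bar>w\<bar>"
        using \<delta> by (simp add: abs_mult)
      then have u: "(1 - 3 / 2 * \<delta>) * \<bar>w\<bar> \<le> \<bar>u\<bar>" "\<bar>u\<bar> \<le> (1 - \<delta> / 2) * \<bar>w\<bar>"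
        using that(3) abs_triangle_ineq2[of u "(1 - \<delta>) * w"] abs_triangle_ineq2_sym[of "(1 - \<delta>) * w" u]
        by (auto simp: algebra_simps)
      have "y = (1 - 3 / 2 * \<delta>) * (K * y)"
        using K(2) by (metis mult.assoc mult.commute mult_1)
      also have "\<dots> \<le> (1 - 3 / 2 * \<delta>) * \<bar>w\<bar>"
        using that \<delta> by (intro mult_left_mono) auto
      finally have "y \<le> \<bar>u\<bar>"
        using u(1) by linarith
      \<comment> \<open>The same product as in \<open>dich_s\<close>, with the roles of the two
        factors exchanged.\<close>
      have "(1 + \<delta> / 2) * \<bar>u\<bar> \<le> (1 + \<delta> / 2) * ((1 - \<delta> / 2) * \<bar>w\<bar>)"
        using u(2) \<delta> by (intro mult_left_mono) auto
      also have "\<dots> = \<bar>w\<bar> - \<delta>\<^sup>2 / 4 * \<bar>w\<bar>"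
        by (simp add: power2_eq_square field_simps)
      also have "\<dots> \<le> \<bar>w\<bar>"
        by simp
      finally have "\<delta> / 2 * \<bar>u\<bar> \<le> \<bar>w\<bar> - \<bar>u\<bar>"
        by (simp add: algebra_simps)
      also have "\<dots> \<le> \<bar>w - 1 * u\<bar>"
        using abs_triangle_ineq2[of w u] by simp
      finally show ?thesis
        using \<open>y \<le> \<bar>u\<bar>\<close> by simp
    qed
    have Ky: "A \<le> K * y" if "A \<le> y" for y
      using that K \<open>A > 0\<close> by (smt (verit) mult_less_cancel_right1)
    have moment_s: "integrable M (\<lambda>\<omega>. (1 + \<bar>X s \<omega>\<bar>) powr P)"
    proof -
      \<comment> \<open>Each tail is controlled by the other one, so it is their sum that contracts
        by 1/3 when the level is multiplied by \<open>K\<close>.\<close>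
      let ?N = "\<lambda>x. ?Ps x + ?Pr x"
      have N: "?N (K * y) \<le> 1/3 * ?N y" if "A \<le> y" for y
      proof -
        have "y > 0" using that \<open>A > 0\<close> by simp
        have "?Ps (K * y) \<le> 1/3 * ?Pr y"
          by (rule tail_le_third_tail[OF _ _ cheb_s[OF Ky[OF that]] cheb_r[OF that] dich_s])
            (use \<open>y > 0\<close> in auto)
        moreover have "?Pr (K * y) \<le> 1/3 * ?Ps y"
          by (rule tail_le_third_tail[OF _ _ cheb_r[OF Ky[OF that]] cheb_s[OF that] dich_r])
            (use \<open>y > 0\<close> in auto)
        ultimately show ?thesis by simp
      qed
      \<comment> \<open>From \<open>\<delta> \<le> 1 / 12\<close> follows
        \<open>K \<le> 8 / 7\<close>, and \<open>ln K\<close> is at most \<open>K - 1\<close>. With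
        \<open>\<delta> = 40 * \<epsilon>\<close> and \<open>P = 1 / (240 * \<epsilon>)\<close> the
        factor \<open>\<epsilon>\<close> cancels and \<open>P * ln K\<close> is at most 2/7; a bound
        by 1 suffices because \<open>exp 1\<close> is at most 3.\<close>
      have "K powr P < 3"
      proof -
        have P: "P = 1 / (240 * \<epsilon>)"
          using False pos by (simp add: P_def max_def field_simps)
        have "K \<le> 8 / 7"
          using \<delta> by (simp add: K_def field_simps)
        have "ln K \<le> K - 1"
          using K(1) by (intro ln_le_minus_one) simp
        also have "\<dots> = 3 / 2 * \<delta> * K"
          using K(2) by (simp add: algebra_simps)
        also have "\<dots> \<le> 3 / 2 * \<delta> * (8 / 7)"
          using \<open>K \<le> 8 / 7\<close> \<delta> by (intro mult_left_mono) auto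
        finally have "P * ln K \<le> P * (3 / 2 * \<delta> * (8 / 7))"
          using \<open>P \<ge> 1\<close> by (intro mult_left_mono) auto
        also have "\<dots> < 1"
          using pos by (simp add: P \<delta>_def)
        finally have "exp (P * ln K) < exp 1"
          by simp
        also have "\<dots> \<le> 3"
          by (rule exp_le)
        finally show ?thesis
          using K(1) by (simp add: powr_def)
      qed
      then have q: "K powr P * (1/3) < 1" by simp
      show "integrable M (\<lambda>\<omega>. (1 + \<bar>X s \<omega>\<bar>) powr P)"
        by (rule integrable_powr_of_geometric_tail[where N = ?N, OF _ _ N])
          (use \<open>A > 0\<close> K \<open>P \<ge> 1\<close> q in auto)
    qed
    show ?thesis
    proof -
      \<comment> \<open>In both nontrivial cases the conditioning is on \<open>X t\<close>, and the
        conditional mean of \<open>X s\<close> is \<open>X t\<close> before \<open>s\<close> and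
        \<open>s / t * X t\<close> after it.\<close>
      consider "t < s" | "t = s" | "s < t" by linarith
      then show ?thesis
      proof cases
        case 1
        then show ?thesis
          using exp_forward[OF that 1] moment_s \<open>P \<ge> 1\<close> \<open>s > 0\<close> that X1
          by (intro integrable_powr_cond_exp_given[of "X t" "X s" P 1]) auto
      next
        case 3
        then show ?thesis
          using exp_backward[OF \<open>s > 0\<close> 3] moment_s \<open>P \<ge> 1\<close> \<open>s > 0\<close> that X1
          by (intro integrable_powr_cond_exp_given[of "X t" "X s" P "s / t"]) auto
      qed (use moment_s in simp)
    qed
  qed
  show ?thesis
  proof (intro allI impI)
    fix t p :: real
    assume t: "t > 0" and p: "0 \<le> p \<and> p \<le> 1 / (240 * sqrt (\<sigma> * \<tau>))"
    have "\<bar>x\<bar> powr p \<le> (1 + \<bar>x\<bar>) powr P" for x :: real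
    proof -
      have "\<bar>x\<bar> powr p \<le> (1 + \<bar>x\<bar>) powr p"
        using p by (intro powr_mono2) auto
      also have "\<dots> \<le> (1 + \<bar>x\<bar>) powr P"
        using p by (intro powr_mono) (auto simp: P_def \<epsilon>_def)
      finally show ?thesis .
    qed
    then have "(\<integral>\<^sup>+\<omega>. ennreal (\<bar>X t \<omega>\<bar> powr p) \<partial>M) \<le> (\<integral>\<^sup>+\<omega>. ennreal ((1 + \<bar>X t \<omega>\<bar>) powr P) \<partial>M)"
      by (intro nn_integral_mono ennreal_leI)
    also have "\<dots> < \<infinity>"
      using moment[OF t] by (simp add: integrable_iff_bounded)
    finally show "(\<integral>\<^sup>+\<omega>. ennreal (\<bar>X t \<omega>\<bar> powr p) \<partial>M) < \<infinity>" .
  qed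
qed

end
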